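(* The critical probability for dyadic tilings satisfies $p_c\geq 0.785996$.
   Context: A dyadic tile of order $n\ge 0$ is a rectangle of the form $\bigl[\frac{a}{2^i},\frac{a+1}{2^i}\bigr]\times\bigl[\frac{b}{2^j},\frac{b+1}{2^j}\bigr]$, where $a,b,i,j\ge 0$ are integers with $i+j=n$, $a<2^i$ and $b<2^j$ (so that the tile is a subset of $[0,1]^2$). A tiling of a rectangle $R$ is a set of tiles whose union is $R$ and whose interiors are pairwise disjoint. For $p\in[0,1]$, each of the $(n+1)2^n$ tiles of order $n$ is available with probability $p$, independently of the others. $T_n(p)$ denotes the probability that there exists a set of available order-$n$ tiles that is a tiling of the unit square $[0,1]^2$. The critical probability is $p_c:=\inf\{p\in[0,1]:\lim_{n\to\infty}T_n(p)=1\}$. *)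

theory Defs
  imports "HOL-Probability.Probability"
begin

definition dyadic_tile :: "nat \<Rightarrow> nat \<Rightarrow> nat \<Rightarrow> nat \<Rightarrow> (real \<times> real) set" where
  "dyadic_tile i j a b =
     {real a / 2 ^ i .. (real a + 1) / 2 ^ i} \<times> {real b / 2 ^ j .. (real b + 1) / 2 ^ j}"

definition dyadic_tiles :: "nat \<Rightarrow> (real \<times> real) set set" where
  "dyadic_tiles n = {dyadic_tile i j a b | i j a b. i + j = n \<and> a < 2 ^ i \<and> b < 2 ^ j}"

definition is_tiling :: "(real \<times> real) set set \<Rightarrow> (real \<times> real) set \<Rightarrow> bool" where
  "is_tiling S R \<longleftrightarrow>
     S \<subseteq> (\<Union>n. dyadic_tiles n) \<and> \<Union>S = R \<and> pairwise (\<lambda>s t. interior s \<inter> interior t = {}) S"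

definition unit_square :: "(real \<times> real) set" where
  "unit_square = {0..1} \<times> {0..1}"

lemma finite_dyadic_tiles: "finite (dyadic_tiles n)"
proof (rule finite_subset)
  show "dyadic_tiles n \<subseteq>
      (\<lambda>(i, j, a, b). dyadic_tile i j a b) ` ({..n} \<times> {..n} \<times> {..<2 ^ n} \<times> {..<2 ^ n})"
  proof
    fix t assume "t \<in> dyadic_tiles n"
    then obtain i j a b where t: "t = dyadic_tile i j a b"
      and "i + j = n" "a < 2 ^ i" "b < 2 ^ j"
      unfolding dyadic_tiles_def by blast
    have "i \<le> n" "j \<le> n" using \<open>i + j = n\<close> by auto
    then have "(2::nat) ^ i \<le> 2 ^ n" "(2::nat) ^ j \<le> 2 ^ n"
      by (auto intro: power_increasing)
    with \<open>a < 2 ^ i\<close> \<open>b < 2 ^ j\<close> have "a < 2 ^ n" "b < 2 ^ n" by linarith+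
    with \<open>i \<le> n\<close> \<open>j \<le> n\<close> have
      "(i, j, a, b) \<in> {..n} \<times> {..n} \<times> {..<2 ^ n} \<times> {..<2 ^ n}" by simp
    then show "t \<in> (\<lambda>(i, j, a, b). dyadic_tile i j a b) `
        ({..n} \<times> {..n} \<times> {..<2 ^ n} \<times> {..<2 ^ n})"
      by (rule rev_image_eqI) (simp add: t)
  qed
qed auto

(* A sample w says which tiles are available; outside the finite index set
   dyadic_tiles n it is constantly False. *)
definition availability :: "nat \<Rightarrow> real \<Rightarrow> ((real \<times> real) set \<Rightarrow> bool) pmf" where
  "availability n p = Pi_pmf (dyadic_tiles n) False (\<lambda>_. bernoulli_pmf p)"

definition tiling_prob :: "nat \<Rightarrow> real \<Rightarrow> real" where
  "tiling_prob n p = measure_pmf.prob (availability n p)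
     {w. \<exists>S. S \<subseteq> {t \<in> dyadic_tiles n. w t} \<and> is_tiling S unit_square}"

definition critical_prob :: real where
  "critical_prob = Inf {p \<in> {0..1}. (\<lambda>n. tiling_prob n p) \<longlonglongrightarrow> 1}"

end

theory Submission
  imports Defs
begin

text \<open>The proof exhibits, for every \<open>p < 0.785996\<close>, a local obstruction to tiling that occurs somewhere
  in the square with probability bounded away from 0, uniformly in the order \<open>n\<close>.

  Cut the unit square into \<open>4^n\<close> cells of side \<open>2^-n\<close>. A cell lies in one tile \<open>U_i\<close> of each shape
  \<open>i = 0..n\<close> (width \<open>2^-i\<close>, height \<open>2^-(n-i)\<close>). It also lies in one rectangle
  \<open>R_i\<close> of order \<open>n - 1\<close> and each shape \<open>i < n\<close>, and the two ways of halving \<open>R_i\<close> pair \<open>U_i\<close> with its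
  vertical sibling and \<open>U_(i+1)\<close> with its horizontal sibling. A tiling of the square by
  tiles of order \<open>n\<close> groups into sibling pairs, so that every tile in it comes with one of its
  two siblings (\<open>tiling_sibling\<close>). Hence the square cannot be tiled if, at some cell, every \<open>U_i\<close> is either
  unavailable or has both siblings unavailable. Call such a cell blocked.

  With \<open>q = 1 - p\<close>, the condition at shape \<open>i\<close> has probability at least \<open>\<beta> = q + p * q^2\<close>, and
  conditions at different shapes involve different tiles. So a cell is blocked with probability at
  least \<open>\<beta>^(n+1)\<close>, and the expected number of blocked cells grows exponentially as soon as
  \<open>4 * \<beta> > 1\<close>. The number \<open>0.785996\<close> is the root of \<open>4 * \<beta> = 1\<close>, rounded down.

  That blocked cells really occur follows by the second moment method
  (\<open>prob_none_le_second_moment\<close>). For two cells, the conditions at shape \<open>i\<close> are independent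
  unless both cells lie in the same two-by-two block of tiles of that shape, and a dependent shape
  costs a factor of at most \<open>1 / \<beta>\<close>. If the dependent shapes lie between \<open>i\<close> and \<open>i + d\<close>, then
  both coordinates of the cells agree up to the scales determined by \<open>i + d\<close> and \<open>i\<close>, which happens
  for a fraction of about \<open>2^-(n+d)\<close> of all pairs of cells. Summing over \<open>i\<close> and \<open>d\<close> leaves a
  convergent geometric series with ratio \<open>1 / (4 * \<beta>)\<close>.\<close>

section \<open>Independence of events on disjoint coordinates\<close>

definition depends_on :: "'a set \<Rightarrow> ('a \<Rightarrow> 'b) set \<Rightarrow> bool" where
  "depends_on A E \<longleftrightarrow> (\<forall>f g. (\<forall>x\<in>A. f x = g x) \<longrightarrow> (f \<in> E \<longleftrightarrow> g \<in> E))"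

lemma depends_on_Int:
  assumes "depends_on A E" "depends_on B F"
  shows   "depends_on (A \<union> B) (E \<inter> F)"
  using assms unfolding depends_on_def by simp blast

lemma depends_on_INT:
  assumes "\<And>i. i \<in> I \<Longrightarrow> depends_on (A i) (E i)"
  shows   "depends_on (\<Union>i\<in>I. A i) (\<Inter>i\<in>I. E i)"
  unfolding depends_on_def
proof (intro allI impI)
  fix f g :: "'b \<Rightarrow> 'c" assume fg: "\<forall>x\<in>\<Union>(A ` I). f x = g x"
  have "f \<in> E i \<longleftrightarrow> g \<in> E i" if "i \<in> I" for i
  proof -
    have "\<forall>x\<in>A i. f x = g x" using fg that by auto
    then show ?thesis using assms[OF that] by (simp add: depends_on_def)
  qed
  then show "f \<in> \<Inter>(E ` I) \<longleftrightarrow> g \<in> \<Inter>(E ` I)" by blast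
qed

lemma prob_pair_Times:
  "measure_pmf.prob (pair_pmf M N) (A \<times> B) = measure_pmf.prob M A * measure_pmf.prob N B"
proof -
  have "measure_pmf.prob (pair_pmf M N) (A \<times> B) =
        measure_pmf.prob (pair_pmf M N) ((A \<inter> set_pmf M) \<times> (B \<inter> set_pmf N))"
    by (intro measure_prob_cong_0) (auto simp: pmf_pair set_pmf_eq)
  also have "\<dots> = measure_pmf.prob M (A \<inter> set_pmf M) * measure_pmf.prob N (B \<inter> set_pmf N)"
    by (intro measure_pmf_prob_product) (auto intro: countable_subset)
  finally show ?thesis by (simp add: measure_Int_set_pmf)
qed

text \<open>Split the product measure into the coordinates in \<open>B\<close> and the others. Coordinates outside \<open>A\<close> are
  constant; they arise from tiles of the extreme shapes, one of whose siblings lies outside the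
  square.\<close>

lemma prob_Pi_pmf_Int:
  assumes fin: "finite A" and E: "depends_on B E" and F: "depends_on C F"
    and disj: "B \<inter> C = {}"
  shows "measure_pmf.prob (Pi_pmf A d p) (E \<inter> F) =
         measure_pmf.prob (Pi_pmf A d p) E * measure_pmf.prob (Pi_pmf A d p) F"
proof -
  define P1 where "P1 = Pi_pmf (A \<inter> B) d p"
  define P2 where "P2 = Pi_pmf (A - B) d p"
  define h where "h = (\<lambda>(f :: 'a \<Rightarrow> 'b, g :: 'a \<Rightarrow> 'b) x. if x \<in> A \<inter> B then f x else g x)"
  have split: "Pi_pmf A d p = map_pmf h (pair_pmf P1 P2)"
    using Pi_pmf_union[of "A \<inter> B" "A - B" d p] fin
    by (auto simp: P1_def P2_def h_def Int_Diff_Un)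
  have supp: "f x = d" if "f \<in> set_pmf P1" "x \<notin> A \<inter> B" for f x
    using that set_Pi_pmf_subset[of "A \<inter> B" d p] fin by (auto simp: P1_def)
  have supp2: "g x = d" if "g \<in> set_pmf P2" "x \<notin> A - B" for g x
    using that set_Pi_pmf_subset[of "A - B" d p] fin by (auto simp: P2_def)
  have key: "measure_pmf.prob (Pi_pmf A d p) (E' \<inter> F') =
             measure_pmf.prob P1 E' * measure_pmf.prob P2 F'"
    if E': "depends_on B E'" and F': "depends_on C F'" for E' F'
  proof -
    have "(h (f, g) \<in> E' \<longleftrightarrow> f \<in> E') \<and> (h (f, g) \<in> F' \<longleftrightarrow> g \<in> F')"
      if "f \<in> set_pmf P1" "g \<in> set_pmf P2" for f g
    proof
      have "\<forall>x\<in>B. h (f, g) x = f x"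
        using supp[OF that(1)] supp2[OF that(2)] by (auto simp: h_def)
      then show "h (f, g) \<in> E' \<longleftrightarrow> f \<in> E'" using E' unfolding depends_on_def by blast
      have "\<forall>x\<in>C. h (f, g) x = g x" using disj by (auto simp: h_def)
      then show "h (f, g) \<in> F' \<longleftrightarrow> g \<in> F'" using F' unfolding depends_on_def by blast
    qed
    then have "measure_pmf.prob (pair_pmf P1 P2) (h -` (E' \<inter> F')) =
               measure_pmf.prob (pair_pmf P1 P2) (E' \<times> F')"
      by (intro measure_prob_cong_0; clarsimp simp: pmf_pair set_pmf_eq; blast)
    then show ?thesis by (simp add: split prob_pair_Times)
  qed
  have U: "depends_on D (UNIV :: ('a \<Rightarrow> 'b) set)" for D by (simp add: depends_on_def)
  show ?thesis using key[OF E F] key[OF E U] key[OF U F] by simp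
qed

lemma prob_Pi_pmf_INT:
  assumes fin: "finite A" and I: "finite I"
    and dep: "\<And>i. i \<in> I \<Longrightarrow> depends_on (D i) (E i)"
    and disj: "disjoint_family_on D I"
  shows "measure_pmf.prob (Pi_pmf A d p) (\<Inter>i\<in>I. E i) =
         (\<Prod>i\<in>I. measure_pmf.prob (Pi_pmf A d p) (E i))"
  using I dep disj
proof (induction I)
  case (insert i I)
  have "D i \<inter> (\<Union>j\<in>I. D j) = {}"
    using insert.prems(2) insert.hyps by (auto simp: disjoint_family_on_def)
  moreover have "depends_on (\<Union>j\<in>I. D j) (\<Inter>j\<in>I. E j)"
    using insert.prems by (intro depends_on_INT) auto
  ultimately have "measure_pmf.prob (Pi_pmf A d p) (E i \<inter> (\<Inter>j\<in>I. E j)) =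
      measure_pmf.prob (Pi_pmf A d p) (E i) * measure_pmf.prob (Pi_pmf A d p) (\<Inter>j\<in>I. E j)"
    using insert.prems by (intro prob_Pi_pmf_Int[OF fin]) auto
  moreover have "measure_pmf.prob (Pi_pmf A d p) (\<Inter>j\<in>I. E j) =
      (\<Prod>i\<in>I. measure_pmf.prob (Pi_pmf A d p) (E i))"
    using insert.prems by (intro insert.IH) (auto simp: disjoint_family_on_def)
  ultimately show ?case using insert.hyps by simp
qed auto

section \<open>The second moment method\<close>

text \<open>Let \<open>W\<close> be the average over \<open>x\<close> of the indicators of \<open>B x\<close>, each divided by its probability.
  Then \<open>W\<close> has mean 1, second moment at most \<open>C\<close>, and vanishes when none of the events occurs. The
  claim follows by comparing \<open>(W - C)^2\<close> with \<open>C^2\<close> on that event. The normalisation by individual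
  probabilities means that these never have to be computed.\<close>

lemma prob_none_le_second_moment:
  fixes M :: "'w pmf" and B :: "'x \<Rightarrow> 'w set"
  assumes X: "finite X" "X \<noteq> {}" and pos: "\<And>x. x \<in> X \<Longrightarrow> measure_pmf.prob M (B x) > 0"
    and C: "C > 0"
    and corr: "(\<Sum>x\<in>X. \<Sum>y\<in>X. measure_pmf.prob M (B x \<inter> B y) /
                 (measure_pmf.prob M (B x) * measure_pmf.prob M (B y))) \<le> C * real (card X) ^ 2"
  shows "measure_pmf.prob M (- (\<Union>x\<in>X. B x)) \<le> 1 - 1 / C"
proof -
  define b where "b x = measure_pmf.prob M (B x)" for x
  define N where "N = real (card X)"
  have N: "N > 0" using X by (simp add: N_def card_gt_0_iff)
  define W where "W w = (\<Sum>x\<in>X. indicat_real (B x) w / b x) / N" for w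
  have int: "integrable (measure_pmf M) (indicat_real S)" for S
    by (intro measure_pmf.integrable_const_bound[of _ 1]) auto
  have W1: "measure_pmf.expectation M W = 1"
  proof -
    have "measure_pmf.expectation M W = (\<Sum>x\<in>X. b x / b x) / N"
      unfolding W_def by (simp add: int b_def)
    also have "(\<Sum>x\<in>X. b x / b x) = (\<Sum>x\<in>X. 1)"
      using pos by (intro sum.cong) (auto simp: b_def less_le)
    finally show ?thesis using N by (simp add: N_def)
  qed
  have W2eq: "W w ^ 2 = (\<Sum>x\<in>X. \<Sum>y\<in>X. indicat_real (B x \<inter> B y) w / (b x * b y)) / N ^ 2" for w
    by (simp add: W_def power2_eq_square sum_product indicator_inter_arith)
  have W2: "measure_pmf.expectation M (\<lambda>w. W w ^ 2) \<le> C"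
  proof -
    have "measure_pmf.expectation M (\<lambda>w. W w ^ 2) =
          (\<Sum>x\<in>X. \<Sum>y\<in>X. measure_pmf.prob M (B x \<inter> B y) / (b x * b y)) / N ^ 2"
      unfolding W2eq by (simp add: int)
    also have "\<dots> \<le> C" using corr N by (simp add: field_simps b_def N_def)
    finally show ?thesis .
  qed
  have iW: "integrable (measure_pmf M) W" unfolding W_def by (simp add: int)
  have iW2: "integrable (measure_pmf M) (\<lambda>w. W w ^ 2)" unfolding W2eq by (simp add: int)
  have "C ^ 2 * measure_pmf.prob M (- (\<Union>x\<in>X. B x)) =
        measure_pmf.expectation M (\<lambda>w. C ^ 2 * indicat_real (- (\<Union>x\<in>X. B x)) w)"
    by simp
  also have "\<dots> \<le> measure_pmf.expectation M (\<lambda>w. W w ^ 2 - 2 * C * W w + C ^ 2)"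
  proof (intro integral_mono)
    fix w
    have "W w ^ 2 - 2 * C * W w + C ^ 2 = (W w - C) ^ 2" by (simp add: power2_diff)
    moreover have "W w = 0" if "w \<in> - (\<Union>x\<in>X. B x)"
      using that by (auto simp: W_def intro!: sum.neutral)
    ultimately show "C ^ 2 * indicat_real (- (\<Union>x\<in>X. B x)) w \<le> W w ^ 2 - 2 * C * W w + C ^ 2"
      by (auto simp: indicator_def)
  qed (auto simp: int iW iW2)
  also have "\<dots> = measure_pmf.expectation M (\<lambda>w. W w ^ 2) - 2 * C + C ^ 2"
    by (simp add: iW iW2 W1)
  also have "\<dots> \<le> C ^ 2 - C" using W2 by simp
  finally have "C ^ 2 * measure_pmf.prob M (- (\<Union>x\<in>X. B x)) \<le> C ^ 2 * (1 - 1 / C)"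
    using C by (simp add: algebra_simps power2_eq_square)
  then show ?thesis using C by (simp only: mult_le_cancel_left_pos zero_less_power)
qed

section \<open>Cells, tiles and siblings\<close>

definition grid_tile :: "nat \<Rightarrow> nat \<Rightarrow> nat \<Rightarrow> nat \<Rightarrow> (real \<times> real) set" where
  "grid_tile n i a b = dyadic_tile i (n - i) a b"

definition tile_at :: "nat \<Rightarrow> nat \<times> nat \<Rightarrow> nat \<Rightarrow> (real \<times> real) set" where
  "tile_at n x i = grid_tile n i (fst x div 2 ^ (n - i)) (snd x div 2 ^ i)"

text \<open>The parity case makes \<open>2 * k\<close> and \<open>2 * k + 1\<close> siblings: the two halves of the interval with
  index \<open>k\<close> at the next coarser scale.\<close>

definition sibling :: "nat \<Rightarrow> nat" where
  "sibling u = (if even u then u + 1 else u - 1)"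

lemma sibling_div2 [simp]: "sibling u div 2 = u div 2"
  by (auto simp: sibling_def elim: oddE)

lemma sibling_neq [simp]: "sibling u \<noteq> u" "u \<noteq> sibling u"
  by (auto simp: sibling_def elim: oddE)

definition hsibling_at :: "nat \<Rightarrow> nat \<times> nat \<Rightarrow> nat \<Rightarrow> (real \<times> real) set" where
  "hsibling_at n x i = grid_tile n i (sibling (fst x div 2 ^ (n - i))) (snd x div 2 ^ i)"

definition vsibling_at :: "nat \<Rightarrow> nat \<times> nat \<Rightarrow> nat \<Rightarrow> (real \<times> real) set" where
  "vsibling_at n x i = grid_tile n i (fst x div 2 ^ (n - i)) (sibling (snd x div 2 ^ i))"

definition cells :: "nat \<Rightarrow> (nat \<times> nat) set" where
  "cells n = {..<2 ^ n} \<times> {..<2 ^ n}"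

text \<open>The local obstruction at shape \<open>i\<close>. At the extreme shapes \<open>i = 0\<close> and \<open>i = n\<close> one sibling lies
  outside the unit square; it is never available, which only makes the event more likely.\<close>

definition stuck :: "nat \<Rightarrow> nat \<times> nat \<Rightarrow> nat \<Rightarrow> ((real \<times> real) set \<Rightarrow> bool) set" where
  "stuck n x i = {w. w (tile_at n x i) \<longrightarrow> \<not> w (hsibling_at n x i) \<and> \<not> w (vsibling_at n x i)}"

lemma dyadic_tile_inject:
  "dyadic_tile i j a b = dyadic_tile i' j' a' b' \<longleftrightarrow> i = i' \<and> j = j' \<and> a = a' \<and> b = b'"
proof
  have interval: "k = k' \<and> c = c'"
    if eq: "{real c / 2 ^ k .. (real c + 1) / 2 ^ k} = {real c' / 2 ^ k' .. (real c' + 1) / 2 ^ k'}"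
    for c c' k k' :: nat
  proof -
    have lo: "real c / 2 ^ k = real c' / 2 ^ k'" and hi: "(real c + 1) / 2 ^ k = (real c' + 1) / 2 ^ k'"
      using eq by (auto simp: Icc_eq_Icc divide_right_mono)
    have "1 / 2 ^ k = (1 / 2 ^ k' :: real)"
      using lo hi by (simp add: add_divide_distrib)
    then have "(2::real) ^ k = 2 ^ k'" by simp
    then have "k = k'" by (subst (asm) power_inject_exp) auto
    with lo show ?thesis by simp
  qed
  assume "dyadic_tile i j a b = dyadic_tile i' j' a' b'"
  then have "{real a / 2 ^ i .. (real a + 1) / 2 ^ i} = {real a' / 2 ^ i' .. (real a' + 1) / 2 ^ i'}"
    "{real b / 2 ^ j .. (real b + 1) / 2 ^ j} = {real b' / 2 ^ j' .. (real b' + 1) / 2 ^ j'}"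
    unfolding dyadic_tile_def by (auto simp: times_eq_iff divide_right_mono)
  then show "i = i' \<and> j = j' \<and> a = a' \<and> b = b'" using interval by blast
qed auto

lemma grid_tile_inject [simp]: "grid_tile n i a b = grid_tile n i' a' b' \<longleftrightarrow> i = i' \<and> a = a' \<and> b = b'"
  by (auto simp: grid_tile_def dyadic_tile_inject)

lemma tile_at_in_dyadic_tiles:
  assumes "x \<in> cells n" "i \<le> n"
  shows   "tile_at n x i \<in> dyadic_tiles n"
proof -
  have "fst x < 2 ^ (n - i) * 2 ^ i" "snd x < 2 ^ i * 2 ^ (n - i)"
    using assms by (auto simp: cells_def simp flip: power_add)
  then have "fst x div 2 ^ (n - i) < 2 ^ i" "snd x div 2 ^ i < 2 ^ (n - i)"
    by (auto simp: div_less_iff_less_mult mult.commute)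
  then show ?thesis using assms unfolding dyadic_tiles_def tile_at_def grid_tile_def
    by (intro CollectI exI[of _ i] exI[of _ "n - i"] exI conjI refl) auto
qed

text \<open>A point in the interior of every dyadic tile that contains the cell, so that membership in the
  closed tile and in its interior coincide.\<close>

definition centre :: "nat \<Rightarrow> nat \<Rightarrow> real" where
  "centre n c = (2 * real c + 1) / 2 ^ Suc n"

lemma centre_in_interval_iff:
  assumes "k \<le> n"
  shows "centre n c \<in> {real a / 2 ^ k .. (real a + 1) / 2 ^ k} \<longleftrightarrow> a = c div 2 ^ (n - k)"
    and "centre n c \<in> {real a / 2 ^ k <..< (real a + 1) / 2 ^ k} \<longleftrightarrow> a = c div 2 ^ (n - k)"
proof -
  have pow: "(2::real) ^ n = 2 ^ k * 2 ^ (n - k)" using assms by (simp flip: power_add)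
  have nat: "a = c div 2 ^ (n - k) \<longleftrightarrow> a * 2 ^ (n - k) \<le> c \<and> c < (a + 1) * 2 ^ (n - k)"
  proof
    assume "a = c div 2 ^ (n - k)"
    then show "a * 2 ^ (n - k) \<le> c \<and> c < (a + 1) * 2 ^ (n - k)"
      using dividend_less_div_times[of "2 ^ (n - k)" c] by simp
  next
    assume "a * 2 ^ (n - k) \<le> c \<and> c < (a + 1) * 2 ^ (n - k)"
    then show "a = c div 2 ^ (n - k)"
      by (intro div_nat_eqI[symmetric]) (simp_all add: mult.commute)
  qed
  have lo: "real e / 2 ^ k = real (2 * (e * 2 ^ (n - k))) / 2 ^ Suc n" for e
    by (simp add: pow)
  have hi: "(real a + 1) / 2 ^ k = real (2 * ((a + 1) * 2 ^ (n - k))) / 2 ^ Suc n"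
    using lo[of "a + 1"] by (simp only: of_nat_add of_nat_1)
  have mid: "centre n c = real (2 * c + 1) / 2 ^ Suc n"
    by (simp add: centre_def)
  have cmp: "real l / 2 ^ Suc n \<le> real m / 2 ^ Suc n \<longleftrightarrow> l \<le> m"
    "real l / 2 ^ Suc n < real m / 2 ^ Suc n \<longleftrightarrow> l < m" for l m
    by (simp_all add: divide_le_cancel divide_less_cancel)
  show "centre n c \<in> {real a / 2 ^ k .. (real a + 1) / 2 ^ k} \<longleftrightarrow> a = c div 2 ^ (n - k)"
    and "centre n c \<in> {real a / 2 ^ k <..< (real a + 1) / 2 ^ k} \<longleftrightarrow> a = c div 2 ^ (n - k)"
    unfolding nat lo hi mid atLeastAtMost_iff greaterThanLessThan_iff cmp by linarith+
qed

lemma centre_in_grid_tile_iff: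
  assumes "i \<le> n"
  shows "(centre n c, centre n d) \<in> grid_tile n i a b \<longleftrightarrow> grid_tile n i a b = tile_at n (c, d) i"
    and "(centre n c, centre n d) \<in> interior (grid_tile n i a b) \<longleftrightarrow> grid_tile n i a b = tile_at n (c, d) i"
proof -
  have "n - (n - i) = i" "n - i \<le> n" using assms by simp_all
  then have d: "centre n d \<in> {real b / 2 ^ (n - i) .. (real b + 1) / 2 ^ (n - i)} \<longleftrightarrow> b = d div 2 ^ i"
    "centre n d \<in> {real b / 2 ^ (n - i) <..< (real b + 1) / 2 ^ (n - i)} \<longleftrightarrow> b = d div 2 ^ i"
    using centre_in_interval_iff[of "n - i" n d b] by simp_all
  have eq: "grid_tile n i a b = tile_at n (c, d) i \<longleftrightarrow> a = c div 2 ^ (n - i) \<and> b = d div 2 ^ i"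
    by (simp add: tile_at_def)
  show "(centre n c, centre n d) \<in> grid_tile n i a b \<longleftrightarrow> grid_tile n i a b = tile_at n (c, d) i"
    unfolding eq unfolding grid_tile_def dyadic_tile_def mem_Sigma_iff
      centre_in_interval_iff(1)[OF assms] d ..
  show "(centre n c, centre n d) \<in> interior (grid_tile n i a b) \<longleftrightarrow> grid_tile n i a b = tile_at n (c, d) i"
    unfolding eq unfolding grid_tile_def dyadic_tile_def interior_Times interior_atLeastAtMost_real
      mem_Sigma_iff centre_in_interval_iff(2)[OF assms] d ..
qed

lemma tiling_cell_unique_shape:
  assumes S: "is_tiling S unit_square" "S \<subseteq> dyadic_tiles n" and x: "x \<in> cells n"
  shows   "\<exists>!i. i \<le> n \<and> tile_at n x i \<in> S"
proof -
  obtain c d where cd: "x = (c, d)" "c < 2 ^ n" "d < 2 ^ n" using x by (auto simp: cells_def)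
  have unit: "centre n e \<in> {0..1}" if "e < 2 ^ n" for e
    using centre_in_interval_iff(1)[of 0 n e 0] that by simp
  have "(centre n c, centre n d) \<in> \<Union>S"
    using S(1) unit cd by (simp add: is_tiling_def unit_square_def)
  then obtain t where t: "t \<in> S" "(centre n c, centre n d) \<in> t" by blast
  then obtain i a b where "i \<le> n" "t = grid_tile n i a b"
  proof -
    obtain i j a b where "t = dyadic_tile i j a b" "i + j = n"
      using t(1) S(2) by (auto simp: dyadic_tiles_def)
    then show ?thesis using that[of i a b] by (auto simp: grid_tile_def)
  qed
  then have ex: "i \<le> n" "tile_at n x i \<in> S" using t centre_in_grid_tile_iff(1) cd by auto
  moreover have "j = i" if j: "j \<le> n" "tile_at n x j \<in> S" for j
  proof (rule ccontr)
    assume "j \<noteq> i"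
    then have "tile_at n x j \<noteq> tile_at n x i" by (simp add: tile_at_def)
    then have "interior (tile_at n x j) \<inter> interior (tile_at n x i) = {}"
      using S(1) j(2) ex(2) unfolding is_tiling_def by (blast dest: pairwiseD)
    moreover have "(centre n c, centre n d) \<in> interior (tile_at n x k)" if "k \<le> n" for k
      using centre_in_grid_tile_iff(2)[OF that, of c d] cd(1) by (simp add: tile_at_def)
    ultimately show False using ex j by blast
  qed
  ultimately show ?thesis by blast
qed

lemma sibling_block:
  fixes c :: nat
  assumes "c < 2 ^ n" "s < n"
  obtains c' where "c' < 2 ^ n" "c' div 2 ^ s = sibling (c div 2 ^ s)"
    "\<And>t. s < t \<Longrightarrow> c' div 2 ^ t = c div 2 ^ t"
proof
  let ?c' = "sibling (c div 2 ^ s) * 2 ^ s"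
  show "?c' div 2 ^ s = sibling (c div 2 ^ s)" by simp
  show coarse: "?c' div 2 ^ t = c div 2 ^ t" if st: "s < t" for t
  proof -
    obtain r where "t = s + Suc r" using less_imp_Suc_add[OF st] by auto
    then have t: "2 ^ t = (2::nat) ^ s * (2 * 2 ^ r)" by (simp add: power_add)
    have "?c' div 2 ^ t = (?c' div 2 ^ s) div 2 div 2 ^ r"
      unfolding t by (simp only: div_mult2_eq)
    also have "\<dots> = (c div 2 ^ s) div 2 div 2 ^ r" by simp
    also have "\<dots> = c div 2 ^ t" unfolding t by (simp only: div_mult2_eq)
    finally show ?thesis .
  qed
  have "?c' div 2 ^ n = 0" using coarse[OF assms(2)] assms(1) by simp
  then show "?c' < 2 ^ n" by (simp only: div_eq_0_iff) simp
qed

section \<open>Blocked cells prevent tilings\<close>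

text \<open>Suppose that the tile at the cell \<open>(c, d)\<close>, of shape \<open>i\<close>, has neither sibling in the tiling. Move
  to a cell \<open>(c, d')\<close> in the vertical sibling. A narrower tile there would also contain \<open>(c, d)\<close>, so
  the tile there must be wider, of some shape \<open>j < i\<close>. Likewise a cell \<open>(c', d)\<close> in the horizontal
  sibling lies in a taller tile, of some shape \<open>k > i\<close>. But both of these tiles contain the
  diagonal cell \<open>(c', d')\<close>, which is impossible in a tiling.\<close>

lemma tiling_sibling:
  assumes S: "is_tiling S unit_square" "S \<subseteq> dyadic_tiles n" and n: "n > 0"
    and x: "x \<in> cells n" and i: "i \<le> n" "tile_at n x i \<in> S"
  shows "hsibling_at n x i \<in> S \<or> vsibling_at n x i \<in> S"
proof (rule ccontr)
  assume no_sib: "\<not> ?thesis"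
  obtain c d where cd: "x = (c, d)" "c < 2 ^ n" "d < 2 ^ n" using x by (auto simp: cells_def)
  have ex: "\<exists>k\<le>n. tile_at n y k \<in> S" if "y \<in> cells n" for y
    using tiling_cell_unique_shape[OF S that] by blast
  have uniq: "k = l" if "y \<in> cells n" "k \<le> n" "l \<le> n" "tile_at n y k \<in> S" "tile_at n y l \<in> S" for y k l
    using tiling_cell_unique_shape[OF S that(1)] that by blast
  have vert: "\<exists>d' j. d' < 2 ^ n \<and> j < i \<and> tile_at n (c, d') j \<in> S \<and>
      (\<forall>t>i. d' div 2 ^ t = d div 2 ^ t)" if lt: "i < n"
  proof -
    obtain d' where d': "d' < 2 ^ n" "d' div 2 ^ i = sibling (d div 2 ^ i)"
      "\<And>t. i < t \<Longrightarrow> d' div 2 ^ t = d div 2 ^ t"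
      using sibling_block[OF cd(3) lt] by metis
    have "(c, d') \<in> cells n" using cd d' by (simp add: cells_def)
    then obtain j where j: "j \<le> n" "tile_at n (c, d') j \<in> S" using ex by blast
    have "\<not> j > i"
    proof
      assume "j > i"
      then have "tile_at n (c, d') j = tile_at n x j" using d' cd by (simp add: tile_at_def)
      then show False using uniq[OF x j(1) i(1)] j i \<open>j > i\<close> by simp
    qed
    moreover have "j \<noteq> i" using no_sib j d' cd by (auto simp: tile_at_def vsibling_at_def)
    ultimately show ?thesis using d' j by (metis linorder_neqE_nat)
  qed
  have horiz: "\<exists>c' k. c' < 2 ^ n \<and> i < k \<and> k \<le> n \<and> tile_at n (c', d) k \<in> S \<and>
      (\<forall>t>n - i. c' div 2 ^ t = c div 2 ^ t)" if "0 < i"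
  proof -
    have lt: "n - i < n" using that n by simp
    obtain c' where c': "c' < 2 ^ n" "c' div 2 ^ (n - i) = sibling (c div 2 ^ (n - i))"
      "\<And>t. n - i < t \<Longrightarrow> c' div 2 ^ t = c div 2 ^ t"
      using sibling_block[OF cd(2) lt] by metis
    have "(c', d) \<in> cells n" using cd c' by (simp add: cells_def)
    then obtain k where k: "k \<le> n" "tile_at n (c', d) k \<in> S" using ex by blast
    have "\<not> k < i"
    proof
      assume "k < i"
      then have "n - i < n - k" using i by simp
      then have "tile_at n (c', d) k = tile_at n x k" using c' cd by (simp add: tile_at_def)
      then show False using uniq[OF x k(1) i(1)] k i \<open>k < i\<close> by simp
    qed
    moreover have "k \<noteq> i" using no_sib k c' cd by (auto simp: tile_at_def hsibling_at_def)
    ultimately show ?thesis using c' k by (metis linorder_neqE_nat)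
  qed
  show False
  proof (cases "0 < i \<and> i < n")
    case False
    (* at an extreme shape no tile is wider, or none is taller, and one neighbour suffices *)
    then show False using vert horiz n i(1) by fastforce
  next
    case True
    then obtain c' k d' j where c': "c' < 2 ^ n" "\<And>t. t > n - i \<Longrightarrow> c' div 2 ^ t = c div 2 ^ t"
      and k: "i < k" "k \<le> n" "tile_at n (c', d) k \<in> S"
      and d': "d' < 2 ^ n" "\<And>t. t > i \<Longrightarrow> d' div 2 ^ t = d div 2 ^ t"
      and j: "j < i" "tile_at n (c, d') j \<in> S"
      using vert horiz by blast
    have "n - i < n - j" using j i by simp
    then have "tile_at n (c', d') j = tile_at n (c, d') j" "tile_at n (c', d') k = tile_at n (c', d) k"
      using c'(2) d'(2) k(1) by (auto simp: tile_at_def)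
    moreover have "(c', d') \<in> cells n" using c' d' by (simp add: cells_def)
    ultimately have "j = k" using uniq[of "(c', d')" j k] j k i by simp
    then show False using j k by simp
  qed
qed

lemma no_tiling_if_stuck:
  assumes "n > 0" "x \<in> cells n" "\<And>i. i \<le> n \<Longrightarrow> w \<in> stuck n x i"
    and S: "S \<subseteq> {t \<in> dyadic_tiles n. w t}" "is_tiling S unit_square"
  shows False
proof -
  have S': "S \<subseteq> dyadic_tiles n" using S by blast
  obtain i where i: "i \<le> n" "tile_at n x i \<in> S"
    using tiling_cell_unique_shape[OF S(2) S' assms(2)] by blast
  then have "hsibling_at n x i \<in> S \<or> vsibling_at n x i \<in> S"
    using tiling_sibling[OF S(2) S'] assms by blast
  then show False using i assms(3)[OF i(1)] S(1) by (auto simp: stuck_def)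
qed

section \<open>The probability that a cell is blocked\<close>

lemma availability_marginal:
  assumes "0 \<le> p" "p \<le> 1"
  shows "measure_pmf.prob (availability n p) {w. \<not> w t} \<ge> 1 - p"
    and "t \<in> dyadic_tiles n \<Longrightarrow> measure_pmf.prob (availability n p) {w. w t} = p"
    and "t \<in> dyadic_tiles n \<Longrightarrow> measure_pmf.prob (availability n p) {w. \<not> w t} = 1 - p"
proof -
  have eq: "measure_pmf.prob (availability n p) {w. w t \<in> B} =
     measure_pmf.prob (if t \<in> dyadic_tiles n then bernoulli_pmf p else return_pmf False) B" for B
  proof -
    have "measure_pmf.prob (availability n p) {w. w t \<in> B} =
          measure_pmf.prob (map_pmf (\<lambda>w. w t) (availability n p)) B"
      by (simp add: vimage_def)
    then show ?thesis
      by (simp only: availability_def Pi_pmf_component[OF finite_dyadic_tiles])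
  qed
  have F: "measure_pmf.prob (availability n p) {w. \<not> w t} =
     (if t \<in> dyadic_tiles n then 1 - p else 1)"
    using eq[of "{False}"] assms by (auto simp: measure_pmf_single)
  have T: "measure_pmf.prob (availability n p) {w. w t} =
     (if t \<in> dyadic_tiles n then p else 0)"
    using eq[of "{True}"] assms by (auto simp: measure_pmf_single)
  show "measure_pmf.prob (availability n p) {w. \<not> w t} \<ge> 1 - p"
    "t \<in> dyadic_tiles n \<Longrightarrow> measure_pmf.prob (availability n p) {w. w t} = p"
    "t \<in> dyadic_tiles n \<Longrightarrow> measure_pmf.prob (availability n p) {w. \<not> w t} = 1 - p"
    using F T assms by auto
qed

definition stuck_bound :: "real \<Rightarrow> real" where
  "stuck_bound p = (1 - p) + p * (1 - p) ^ 2"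

text \<open>Either the tile is unavailable, or it is available and its two siblings are not. Equality holds
  unless a sibling lies outside the square.\<close>

lemma prob_stuck_ge:
  assumes p: "0 \<le> p" "p \<le> 1" and x: "x \<in> cells n" "i \<le> n"
  shows "measure_pmf.prob (availability n p) (stuck n x i) \<ge> stuck_bound p"
proof -
  let ?P = "measure_pmf.prob (availability n p)"
  define u h v where "u = tile_at n x i" and "h = hsibling_at n x i" and "v = vsibling_at n x i"
  have u: "u \<in> dyadic_tiles n" using tile_at_in_dyadic_tiles x by (simp add: u_def)
  have neq: "u \<noteq> h" "u \<noteq> v" "h \<noteq> v"
    by (simp_all add: u_def h_def v_def tile_at_def hsibling_at_def vsibling_at_def)
  have "?P ({w. w u} \<inter> ({w. \<not> w h} \<inter> {w. \<not> w v})) = ?P {w. w u} * ?P ({w. \<not> w h} \<inter> {w. \<not> w v})"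
    unfolding availability_def using neq
    by (intro prob_Pi_pmf_Int[of _ "{u}" _ "{h, v}"] finite_dyadic_tiles) (auto simp: depends_on_def)
  also have "?P ({w. \<not> w h} \<inter> {w. \<not> w v}) = ?P {w. \<not> w h} * ?P {w. \<not> w v}"
    unfolding availability_def using neq
    by (intro prob_Pi_pmf_Int[of _ "{h}" _ "{v}"] finite_dyadic_tiles) (auto simp: depends_on_def)
  also have "?P {w. w u} * \<dots> \<ge> p * ((1 - p) * (1 - p))"
    using availability_marginal(1,2)[OF p] u p by (auto intro!: mult_mono)
  finally have "?P ({w. w u} \<inter> ({w. \<not> w h} \<inter> {w. \<not> w v})) \<ge> p * (1 - p) ^ 2"
    by (simp add: power2_eq_square)
  moreover have "?P (stuck n x i) = ?P {w. \<not> w u} + ?P ({w. w u} \<inter> ({w. \<not> w h} \<inter> {w. \<not> w v}))"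
    by (subst measure_pmf.finite_measure_Union[symmetric])
       (auto simp: stuck_def u_def h_def v_def intro!: arg_cong[where f = ?P])
  ultimately show ?thesis using availability_marginal(3)[OF p u] by (simp add: stuck_bound_def)
qed

definition sibling_group :: "nat \<Rightarrow> nat \<times> nat \<Rightarrow> nat \<Rightarrow> (real \<times> real) set set" where
  "sibling_group n x i = {tile_at n x i, hsibling_at n x i, vsibling_at n x i}"

lemma depends_on_stuck: "depends_on (sibling_group n x i) (stuck n x i)"
  by (simp add: depends_on_def stuck_def sibling_group_def)

section \<open>Correlation between two cells\<close>

text \<open>At shape \<open>i\<close> the tile containing a cell and its two siblings stay within the two-by-two block of
  tiles around it. Two cells interact at shape \<open>i\<close> only if their blocks have the same column
  (\<open>hclash\<close>) and the same row (\<open>vclash\<close>).\<close>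

definition hclash :: "nat \<Rightarrow> nat \<times> nat \<Rightarrow> nat \<times> nat \<Rightarrow> nat \<Rightarrow> bool" where
  "hclash n x y i \<longleftrightarrow> fst x div (2 ^ (n - i) * 2) = fst y div (2 ^ (n - i) * 2)"

definition vclash :: "nat \<times> nat \<Rightarrow> nat \<times> nat \<Rightarrow> nat \<Rightarrow> bool" where
  "vclash x y i \<longleftrightarrow> snd x div (2 ^ i * 2) = snd y div (2 ^ i * 2)"

lemma sibling_group_block:
  assumes "t \<in> sibling_group n x i"
  obtains a b where "t = grid_tile n i a b"
    "a div 2 = fst x div (2 ^ (n - i) * 2)" "b div 2 = snd x div (2 ^ i * 2)"
  using assms that
  by (auto simp: sibling_group_def tile_at_def hsibling_at_def vsibling_at_def div_mult2_eq simp del: div_exp_eq)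

lemma sibling_group_disjoint:
  assumes "i \<noteq> j \<or> \<not> (hclash n x y i \<and> vclash x y i)"
  shows   "sibling_group n x i \<inter> sibling_group n y j = {}"
proof -
  have False if "t \<in> sibling_group n x i" "t \<in> sibling_group n y j" for t
    using assms sibling_group_block[OF that(1)] sibling_group_block[OF that(2)]
    by (metis hclash_def vclash_def grid_tile_inject)
  then show ?thesis by blast
qed

definition blocked :: "nat \<Rightarrow> nat \<times> nat \<Rightarrow> ((real \<times> real) set \<Rightarrow> bool) set" where
  "blocked n x = (\<Inter>i\<in>{..n}. stuck n x i)"

lemma prob_blocked:
  "measure_pmf.prob (availability n p) (blocked n x) =
   (\<Prod>i\<le>n. measure_pmf.prob (availability n p) (stuck n x i))"
  unfolding blocked_def availability_def
  by (rule prob_Pi_pmf_INT[where D = "sibling_group n x"])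
     (auto simp: finite_dyadic_tiles depends_on_stuck disjoint_family_on_def
       dest!: sibling_group_disjoint[of _ _ n x x, OF disjI1])

lemma prob_blocked_pair:
  "measure_pmf.prob (availability n p) (blocked n x \<inter> blocked n y) =
   (\<Prod>i\<le>n. measure_pmf.prob (availability n p) (stuck n x i \<inter> stuck n y i))"
proof -
  have "blocked n x \<inter> blocked n y = (\<Inter>i\<in>{..n}. stuck n x i \<inter> stuck n y i)"
    by (auto simp: blocked_def)
  moreover have "disjoint_family_on (\<lambda>i. sibling_group n x i \<union> sibling_group n y i) {..n}"
    unfolding disjoint_family_on_def using sibling_group_disjoint by blast
  ultimately show ?thesis unfolding availability_def
    by (simp add: prob_Pi_pmf_INT[where D = "\<lambda>i. sibling_group n x i \<union> sibling_group n y i"]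
        finite_dyadic_tiles depends_on_Int depends_on_stuck)
qed

text \<open>When the blocks coincide, nothing better is used than that the joint probability is at most either
  single one.\<close>

lemma prob_stuck_pair_ratio:
  fixes p :: real and n i :: nat and x y :: "nat \<times> nat"
  defines "P \<equiv> measure_pmf.prob (availability n p)"
  assumes p: "0 \<le> p" "p < 1" and x: "x \<in> cells n" "y \<in> cells n" "i \<le> n"
  shows "P (stuck n x i \<inter> stuck n y i) / (P (stuck n x i) * P (stuck n y i))
         \<le> (if hclash n x y i \<and> vclash x y i then 1 / stuck_bound p else 1)"
proof -
  have b: "stuck_bound p > 0" using p by (simp add: stuck_bound_def add_pos_nonneg)
  have ge: "P (stuck n z i) \<ge> stuck_bound p" if "z \<in> cells n" for z
    unfolding P_def using prob_stuck_ge p that x by simp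
  have pos: "P (stuck n x i) > 0" "P (stuck n y i) > 0"
    using ge[OF x(1)] ge[OF x(2)] b by linarith+
  show ?thesis
  proof (cases "hclash n x y i \<and> vclash x y i")
    case True
    have "P (stuck n x i \<inter> stuck n y i) \<le> P (stuck n x i)"
      unfolding P_def by (intro measure_pmf.finite_measure_mono) auto
    then have "P (stuck n x i \<inter> stuck n y i) / (P (stuck n x i) * P (stuck n y i))
        \<le> P (stuck n x i) / (P (stuck n x i) * P (stuck n y i))"
      using pos by (intro divide_right_mono) auto
    also have "\<dots> = 1 / P (stuck n y i)" using pos by simp
    also have "\<dots> \<le> 1 / stuck_bound p" using ge[OF x(2)] b by (intro divide_left_mono) auto
    finally show ?thesis using True by simp
  next
    case False
    then have "P (stuck n x i \<inter> stuck n y i) = P (stuck n x i) * P (stuck n y i)"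
      unfolding P_def availability_def
      by (intro prob_Pi_pmf_Int[OF finite_dyadic_tiles depends_on_stuck depends_on_stuck]
          sibling_group_disjoint) auto
    then show ?thesis unfolding if_not_P[OF False] using pos by simp
  qed
qed

section \<open>Counting correlated pairs of cells\<close>

lemma card_same_block_le:
  fixes m N :: nat
  assumes "m > 0"
  shows "card {(a, b). a < N \<and> b < N \<and> a div m = b div m} \<le> N * m"
proof -
  have block: "{b. b div m = k} \<subseteq> {k * m..<k * m + m}" for k
    using assms dividend_less_div_times[of m] by (auto simp: add.commute)
  then have fin: "finite {b. b div m = k}" and card: "card {b. b div m = k} \<le> m" for k
    using finite_subset[OF block[of k]] card_mono[OF _ block[of k]] by auto
  have "card {(a, b). a < N \<and> b < N \<and> a div m = b div m} \<le>
        card (SIGMA a:{..<N}. {b. b div m = a div m})"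
    by (intro card_mono finite_SigmaI fin) auto
  also have "\<dots> = (\<Sum>a<N. card {b. b div m = a div m})"
    using fin by (simp add: card_SigmaI)
  also have "\<dots> \<le> (\<Sum>a<N. m)" by (intro sum_mono card)
  finally show ?thesis by simp
qed

text \<open>The indices counted on the left lie between their minimum \<open>i\<close> and maximum \<open>i + d\<close>, and the
  summand for this pair alone dominates the left-hand side. Of the condition at the maximum only \<open>H\<close>
  is kept and of the condition at the minimum only \<open>V\<close>: these are the more restrictive halves when
  \<open>H\<close> and \<open>V\<close> say that two cells agree horizontally and vertically.\<close>

lemma power_card_le_sum:
  fixes g :: real
  assumes g: "g \<ge> 1"
  shows "g ^ card {i. i \<le> n \<and> H i \<and> V i}
    \<le> 1 + (\<Sum>d\<le>n. \<Sum>i\<le>n - d. of_bool (H (i + d) \<and> V i) * g ^ Suc d)"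
proof (cases "{i. i \<le> n \<and> H i \<and> V i} = {}")
  case True
  have "0 \<le> (\<Sum>d\<le>n. \<Sum>i\<le>n - d. of_bool (H (i + d) \<and> V i) * g ^ Suc d)"
    using g by (intro sum_nonneg mult_nonneg_nonneg) auto
  then show ?thesis unfolding True card.empty power_0 by linarith
next
  case False
  define I where "I = {i. i \<le> n \<and> H i \<and> V i}"
  have fin: "finite I" by (simp add: I_def)
  have mem: "Min I \<in> I" "Max I \<in> I" using False fin by (auto simp: I_def[symmetric])
  have le: "Min I \<le> Max I" using mem fin by simp
  define d where "d = Max I - Min I"
  have d: "d \<le> n" "Min I \<le> n - d" "Min I + d = Max I"
    using mem le by (auto simp: d_def I_def)
  have "I \<subseteq> {Min I..Max I}" using fin by auto
  then have "card I \<le> Suc d" using card_mono[of "{Min I..Max I}" I] le by (simp add: d_def Suc_diff_le)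
  then have "g ^ card I \<le> of_bool (H (Min I + d) \<and> V (Min I)) * g ^ Suc d"
    using g mem d by (auto simp: I_def intro!: power_increasing simp del: power_Suc)
  also have "\<dots> \<le> (\<Sum>i\<le>n - d. of_bool (H (i + d) \<and> V i) * g ^ Suc d)"
    using d g by (intro member_le_sum[of "Min I" _ "\<lambda>i. of_bool (H (i + d) \<and> V i) * g ^ Suc d"]) auto
  also have "\<dots> \<le> (\<Sum>d\<le>n. \<Sum>i\<le>n - d. of_bool (H (i + d) \<and> V i) * g ^ Suc d)"
    using d g by (intro member_le_sum[of d _
      "\<lambda>d. \<Sum>i\<le>n - d. of_bool (H (i + d) \<and> V i) * g ^ Suc d"] sum_nonneg) auto
  finally show ?thesis by (simp add: I_def)
qed

lemma card_clash_le:
  assumes "i + d \<le> n"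
  shows "card {(x, y). x \<in> cells n \<and> y \<in> cells n \<and> hclash n x y (i + d) \<and> vclash x y i}
         \<le> 4 * 4 ^ n * 2 ^ (n - d)"
proof -
  define R where "R m = {(a, b). a < 2 ^ n \<and> b < 2 ^ n \<and> a div m = b div m}" for m :: nat
  have fin: "finite (R m)" for m
    by (rule finite_subset[of _ "{..<2 ^ n} \<times> {..<2 ^ n}"]) (auto simp: R_def)
  let ?S = "{(x, y). x \<in> cells n \<and> y \<in> cells n \<and> hclash n x y (i + d) \<and> vclash x y i}"
  let ?k = "2 ^ (n - (i + d)) * 2" and ?l = "2 ^ i * 2"
  let ?f = "\<lambda>((a, b), (a', b')). ((a, a'), (b, b')) :: (nat \<times> nat) \<times> (nat \<times> nat)"
  have "card ?S \<le> card (R ?k \<times> R ?l)"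
    by (rule card_inj_on_le[of ?f])
       (auto simp: inj_on_def R_def cells_def hclash_def vclash_def fin[unfolded R_def])
  also have "\<dots> \<le> (2 ^ n * ?k) * (2 ^ n * ?l)"
    unfolding card_cartesian_product R_def by (intro mult_le_mono card_same_block_le) auto
  also have "\<dots> = 4 * (2 ^ n * 2 ^ n) * (2 ^ (n - (i + d)) * 2 ^ i)" by simp
  also have "2 ^ n * 2 ^ n = (4 :: nat) ^ n" by (simp flip: power_mult_distrib)
  also have "2 ^ (n - (i + d)) * 2 ^ i = (2 :: nat) ^ (n - d)"
    using assms by (simp flip: power_add)
  finally show ?thesis .
qed

text \<open>The factor \<open>n - d + 1\<close> counts the positions of a window of length \<open>d\<close>. It is absorbed by a
  second factor \<open>2 ^ (n - d)\<close>, which yields a plain geometric sum with ratio \<open>g / 4\<close>.\<close>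

lemma weighted_geometric_le:
  fixes g :: real
  assumes g: "0 \<le> g" "g < 4"
  shows "(\<Sum>d\<le>n. real (Suc (n - d)) * g ^ d * 2 ^ (n - d)) \<le> 4 ^ n / (1 - g / 4)"
proof -
  have "(\<Sum>d\<le>n. real (Suc (n - d)) * g ^ d * 2 ^ (n - d)) \<le> (\<Sum>d\<le>n. 4 ^ n * (g / 4) ^ d)"
  proof (intro sum_mono)
    fix d assume d: "d \<in> {..n}"
    have "Suc (n - d) \<le> 2 ^ (n - d)" by (simp only: Suc_le_eq less_exp)
    then have "real (Suc (n - d)) \<le> 2 ^ (n - d)" by (metis of_nat_le_iff of_nat_numeral of_nat_power)
    then have "real (Suc (n - d)) * g ^ d * 2 ^ (n - d) \<le> 2 ^ (n - d) * g ^ d * 2 ^ (n - d)"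
      using g by (intro mult_right_mono) auto
    also have "\<dots> = 4 ^ (n - d) * g ^ d" by (simp flip: power_mult_distrib)
    also have "\<dots> = 4 ^ n * (g / 4) ^ d" using d by (simp add: power_diff power_divide)
    finally show "real (Suc (n - d)) * g ^ d * 2 ^ (n - d) \<le> 4 ^ n * (g / 4) ^ d" .
  qed
  also have "\<dots> = 4 ^ n * (\<Sum>d\<le>n. (g / 4) ^ d)" by (simp add: sum_distrib_left)
  also have "\<dots> \<le> 4 ^ n * (1 / (1 - g / 4))"
  proof (intro mult_left_mono)
    have "(\<Sum>d\<le>n. (g / 4) ^ d) \<le> (\<Sum>d. (g / 4) ^ d)"
      using g by (intro sum_le_suminf summable_geometric) auto
    then show "(\<Sum>d\<le>n. (g / 4) ^ d) \<le> 1 / (1 - g / 4)"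
      using g by (simp add: suminf_geometric)
  qed auto
  finally show ?thesis by simp
qed

section \<open>The lower bound for the critical probability\<close>

text \<open>The bound is uniform in \<open>n\<close>. Its denominator bounds the normalised second moment: 1 comes from
  independent pairs of cells, and the other summand from all windows of dependent shapes.\<close>

lemma tiling_prob_le:
  assumes p: "0 \<le> p" "p < 1" and b: "4 * stuck_bound p > 1" and n: "n > 0"
  defines "g \<equiv> 1 / stuck_bound p"
  shows "tiling_prob n p \<le> 1 - 1 / (1 + 4 * g / (1 - g / 4))"
proof -
  let ?P = "measure_pmf.prob (availability n p)"
  define C where "C = 1 + 4 * g / (1 - g / 4)"
  have bpos: "stuck_bound p > 0" using b by simp
  have "p * (1 - p) ^ 2 \<le> p * 1"
    using p by (intro mult_left_mono power_le_one) auto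
  then have "stuck_bound p \<le> 1" by (simp add: stuck_bound_def)
  then have g: "1 \<le> g" "g < 4" using b bpos by (auto simp: g_def field_simps)
  have fin: "finite (cells n)" by (simp add: cells_def)
  have cardN: "real (card (cells n)) = 4 ^ n"
    by (simp add: cells_def card_cartesian_product flip: power_mult_distrib)
  have "?P (- (\<Union>x\<in>cells n. blocked n x)) \<le> 1 - 1 / C"
  proof (rule prob_none_le_second_moment[OF fin])
    show "cells n \<noteq> {}" by (auto simp: cells_def lessThan_empty_iff)
    show "C > 0" using g by (auto simp: C_def intro!: add_pos_nonneg)
    fix x assume x: "x \<in> cells n"
    have "?P (stuck n x i) > 0" if "i \<le> n" for i
      using prob_stuck_ge[of p x n i] p x that bpos by simp
    then show "?P (blocked n x) > 0" unfolding prob_blocked by (intro prod_pos) auto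
  next
    let ?c = "\<lambda>x y d i. of_bool (hclash n x y (i + d) \<and> vclash x y i) :: real"
    have ratio: "?P (blocked n x \<inter> blocked n y) / (?P (blocked n x) * ?P (blocked n y))
        \<le> 1 + (\<Sum>d\<le>n. \<Sum>i\<le>n - d. ?c x y d i * g ^ Suc d)"
      if xy: "x \<in> cells n" "y \<in> cells n" for x y
    proof -
      have "?P (blocked n x \<inter> blocked n y) / (?P (blocked n x) * ?P (blocked n y)) =
        (\<Prod>i\<le>n. ?P (stuck n x i \<inter> stuck n y i) / (?P (stuck n x i) * ?P (stuck n y i)))"
        by (simp add: prob_blocked prob_blocked_pair prod_dividef prod.distrib)
      also have "\<dots> \<le> (\<Prod>i\<le>n. if hclash n x y i \<and> vclash x y i then g else 1)"
        unfolding g_def using prob_stuck_pair_ratio[OF p xy] by (intro prod_mono) auto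
      also have "\<dots> = g ^ card {i. i \<le> n \<and> hclash n x y i \<and> vclash x y i}"
      proof -
        have "{i. i \<le> n \<and> hclash n x y i \<and> vclash x y i} =
              {..n} \<inter> {i. hclash n x y i \<and> vclash x y i}" by auto
        then show ?thesis by (simp only: prod.If_cases finite_atMost prod_constant power_one mult_1_right)
      qed
      also have "\<dots> \<le> 1 + (\<Sum>d\<le>n. \<Sum>i\<le>n - d. ?c x y d i * g ^ Suc d)"
        by (rule power_card_le_sum[OF g(1)])
      finally show ?thesis .
    qed
    have count: "(\<Sum>x\<in>cells n. \<Sum>y\<in>cells n. ?c x y d i) \<le> 4 * 4 ^ n * 2 ^ (n - d)"
      if "i + d \<le> n" for i d
    proof -
      have "(\<Sum>x\<in>cells n. \<Sum>y\<in>cells n. ?c x y d i) =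
        (\<Sum>(x, y)\<in>cells n \<times> cells n. ?c x y d i)" by (simp add: sum.cartesian_product)
      also have "\<dots> = real (card ((cells n \<times> cells n) \<inter> {(x, y). hclash n x y (i + d) \<and> vclash x y i}))"
        using fin by (simp add: case_prod_unfold sum_of_bool_eq del: of_bool_conj)
      also have "(cells n \<times> cells n) \<inter> {(x, y). hclash n x y (i + d) \<and> vclash x y i} =
        {(x, y). x \<in> cells n \<and> y \<in> cells n \<and> hclash n x y (i + d) \<and> vclash x y i}" by auto
      also have "real (card \<dots>) \<le> real (4 * 4 ^ n * 2 ^ (n - d))"
        using card_clash_le[OF that] by (simp only: of_nat_le_iff)
      finally show ?thesis by simp
    qed
    have "(\<Sum>x\<in>cells n. \<Sum>y\<in>cells n. ?P (blocked n x \<inter> blocked n y) / (?P (blocked n x) * ?P (blocked n y)))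
      \<le> (\<Sum>x\<in>cells n. \<Sum>y\<in>cells n. 1 + (\<Sum>d\<le>n. \<Sum>i\<le>n - d. ?c x y d i * g ^ Suc d))"
      by (intro sum_mono ratio)
    also have "\<dots> = 4 ^ n * 4 ^ n +
        (\<Sum>x\<in>cells n. \<Sum>y\<in>cells n. \<Sum>d\<le>n. \<Sum>i\<le>n - d. ?c x y d i * g ^ Suc d)"
      by (simp only: sum.distrib sum_constant cardN mult_1_right)
    also have "(\<Sum>x\<in>cells n. \<Sum>y\<in>cells n. \<Sum>d\<le>n. \<Sum>i\<le>n - d. ?c x y d i * g ^ Suc d) =
        (\<Sum>d\<le>n. \<Sum>i\<le>n - d. \<Sum>x\<in>cells n. \<Sum>y\<in>cells n. ?c x y d i * g ^ Suc d)"
    proof -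
      have "(\<Sum>x\<in>cells n. \<Sum>y\<in>cells n. \<Sum>d\<le>n. \<Sum>i\<le>n - d. ?c x y d i * g ^ Suc d) =
        (\<Sum>x\<in>cells n. \<Sum>d\<le>n. \<Sum>y\<in>cells n. \<Sum>i\<le>n - d. ?c x y d i * g ^ Suc d)"
        by (intro sum.cong refl sum.swap)
      also have "\<dots> = (\<Sum>d\<le>n. \<Sum>x\<in>cells n. \<Sum>y\<in>cells n. \<Sum>i\<le>n - d. ?c x y d i * g ^ Suc d)"
        by (rule sum.swap)
      also have "\<dots> = (\<Sum>d\<le>n. \<Sum>x\<in>cells n. \<Sum>i\<le>n - d. \<Sum>y\<in>cells n. ?c x y d i * g ^ Suc d)"
        by (intro sum.cong refl sum.swap)
      also have "\<dots> = (\<Sum>d\<le>n. \<Sum>i\<le>n - d. \<Sum>x\<in>cells n. \<Sum>y\<in>cells n. ?c x y d i * g ^ Suc d)"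
        by (intro sum.cong refl sum.swap)
      finally show ?thesis .
    qed
    also have "\<dots> = (\<Sum>d\<le>n. \<Sum>i\<le>n - d. (\<Sum>x\<in>cells n. \<Sum>y\<in>cells n. ?c x y d i) * g ^ Suc d)"
      by (simp only: sum_distrib_right)
    also have "\<dots> \<le> (\<Sum>d\<le>n. \<Sum>i\<le>n - d. (4 * 4 ^ n * 2 ^ (n - d)) * g ^ Suc d)"
      using g by (intro sum_mono mult_right_mono count) auto
    also have "\<dots> = 4 * g * 4 ^ n * (\<Sum>d\<le>n. real (Suc (n - d)) * g ^ d * 2 ^ (n - d))"
      by (simp add: sum_distrib_left mult_ac)
    also have "\<dots> \<le> 4 * g * 4 ^ n * (4 ^ n / (1 - g / 4))"
      using g by (intro mult_left_mono weighted_geometric_le) auto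
    also have "4 ^ n * 4 ^ n + 4 * g * 4 ^ n * (4 ^ n / (1 - g / 4)) = C * real (card (cells n)) ^ 2"
      unfolding cardN by (simp add: C_def power2_eq_square algebra_simps)
    finally show "(\<Sum>x\<in>cells n. \<Sum>y\<in>cells n.
        ?P (blocked n x \<inter> blocked n y) / (?P (blocked n x) * ?P (blocked n y)))
      \<le> C * real (card (cells n)) ^ 2" by simp
  qed
  moreover have "tiling_prob n p \<le> ?P (- (\<Union>x\<in>cells n. blocked n x))"
    unfolding tiling_prob_def using no_tiling_if_stuck[OF n]
    by (intro measure_pmf.finite_measure_mono) (auto simp: blocked_def, blast)
  ultimately show ?thesis by (simp add: C_def)
qed

lemma stuck_bound_gt_quarter:
  assumes "0 \<le> p" "p < 0.785996"
  shows   "4 * stuck_bound p > 1"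
proof -
  define q where "q = 1 - p"
  have q: "0.214004 < q" "q \<le> 1" using assms by (auto simp: q_def)
  have "stuck_bound p = q + (1 - q) * q ^ 2" by (simp add: stuck_bound_def q_def)
  (* factor q - 0.214004 out of the increment of the cubic q + q^2 - q^3; the cofactor is nonnegative *)
  also have "\<dots> = 0.214004 + 0.214004 ^ 2 - 0.214004 ^ 3 +
      (q - 0.214004) * (1 + (q + 0.214004) - (q ^ 2 + 0.214004 * q + 0.214004 ^ 2))"
    by (simp add: field_simps power2_eq_square power3_eq_cube)
  finally have eq: "stuck_bound p = 0.214004 + 0.214004 ^ 2 - 0.214004 ^ 3 +
      (q - 0.214004) * (1 + (q + 0.214004) - (q ^ 2 + 0.214004 * q + 0.214004 ^ 2))" .
  have "q ^ 2 \<le> 1 * q" "0.214004 * q \<le> 0.214004 * 1" "(0.214004::real) ^ 2 \<le> 1"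
    using q by (auto simp: power2_eq_square)
  then have "(q - 0.214004) * (1 + (q + 0.214004) - (q ^ 2 + 0.214004 * q + 0.214004 ^ 2)) \<ge> 0"
    using q by (intro mult_nonneg_nonneg) linarith+
  then have "stuck_bound p \<ge> 0.214004 + 0.214004 ^ 2 - 0.214004 ^ 3" using eq by linarith
  moreover have "(0.214004::real) + 0.214004 ^ 2 - 0.214004 ^ 3 > 1 / 4"
    by (simp add: power2_eq_square power3_eq_cube)
  ultimately show ?thesis by linarith
qed

lemma tiling_prob_not_tendsto_1:
  assumes "0 \<le> p" "p < 1" "4 * stuck_bound p > 1"
  shows   "\<not> (\<lambda>n. tiling_prob n p) \<longlonglongrightarrow> 1"
proof
  assume lim: "(\<lambda>n. tiling_prob n p) \<longlonglongrightarrow> 1"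
  define g where "g = 1 / stuck_bound p"
  have g: "0 < g" "g < 4" using assms by (auto simp: g_def field_simps)
  have "eventually (\<lambda>n. tiling_prob n p \<le> 1 - 1 / (1 + 4 * g / (1 - g / 4))) sequentially"
    using eventually_gt_at_top[of 0]
    by eventually_elim (use tiling_prob_le[OF assms] in \<open>simp add: g_def\<close>)
  then have "1 \<le> 1 - 1 / (1 + 4 * g / (1 - g / 4))"
    by (intro tendsto_upperbound[OF lim]) auto
  moreover have "1 + 4 * g / (1 - g / 4) > 0" using g by (intro add_pos_nonneg) auto
  ultimately show False by simp
qed

lemma column_in_dyadic_tiles: "a < 2 ^ n \<Longrightarrow> dyadic_tile n 0 a 0 \<in> dyadic_tiles n"
  unfolding dyadic_tiles_def
  by (intro CollectI exI[of _ n] exI[of _ 0] exI[of _ a]) auto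

text \<open>Together with \<open>tiling_prob_1\<close> this shows that the infimum in \<open>critical_prob\<close> is taken over a
  nonempty set; the infimum of the empty set of reals would carry no information.\<close>

lemma columns_tile_unit_square: "is_tiling ((\<lambda>a. dyadic_tile n 0 a 0) ` {..<2 ^ n}) unit_square"
  unfolding is_tiling_def
proof (intro conjI)
  show "(\<lambda>a. dyadic_tile n 0 a 0) ` {..<2 ^ n} \<subseteq> (\<Union>n. dyadic_tiles n)"
    using column_in_dyadic_tiles by blast
  show "\<Union> ((\<lambda>a. dyadic_tile n 0 a 0) ` {..<2 ^ n}) = unit_square"
  proof (intro equalityI subsetI)
    fix z assume "z \<in> \<Union> ((\<lambda>a. dyadic_tile n 0 a 0) ` {..<2 ^ n})"
    then obtain a where a: "a < 2 ^ n" "z \<in> dyadic_tile n 0 a 0" by auto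
    have "real (a + 1) \<le> real (2 ^ n)" using a(1) by (subst of_nat_le_iff) simp
    then have "real a + 1 \<le> 2 ^ n" by simp
    then have bounds: "(real a + 1) / 2 ^ n \<le> 1" "0 \<le> real a / 2 ^ n" by simp_all
    show "z \<in> unit_square"
      using a(2) order_trans[OF bounds(2)] order_trans[OF _ bounds(1)]
      by (auto simp: dyadic_tile_def unit_square_def)
  next
    fix z assume "z \<in> unit_square"
    then obtain s t where z: "z = (s, t)" "0 \<le> s" "s \<le> 1" "0 \<le> t" "t \<le> 1"
      by (auto simp: unit_square_def)
    have "\<exists>a<2 ^ n. real a \<le> s * 2 ^ n \<and> s * 2 ^ n \<le> real a + 1"
    proof (cases "s = 1")
      case True
      then show ?thesis by (intro exI[of _ "2 ^ n - 1"]) (simp add: of_nat_diff)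
    next
      case False
      then have "s * 2 ^ n < 2 ^ n" using z by simp
      then have "nat \<lfloor>s * 2 ^ n\<rfloor> < 2 ^ n" using z by (simp add: nat_less_iff floor_less_iff)
      moreover have "real (nat \<lfloor>s * 2 ^ n\<rfloor>) = of_int \<lfloor>s * 2 ^ n\<rfloor>" using z by simp
      ultimately show ?thesis by (intro exI[of _ "nat \<lfloor>s * 2 ^ n\<rfloor>"]) linarith
    qed
    then obtain a where a: "a < 2 ^ n" "real a \<le> s * 2 ^ n" "s * 2 ^ n \<le> real a + 1" by blast
    then have "z \<in> dyadic_tile n 0 a 0"
      using z by (simp add: dyadic_tile_def pos_divide_le_eq pos_le_divide_eq)
    then show "z \<in> \<Union> ((\<lambda>a. dyadic_tile n 0 a 0) ` {..<2 ^ n})" using a(1) by blast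
  qed
  show "pairwise (\<lambda>s t. interior s \<inter> interior t = {}) ((\<lambda>a. dyadic_tile n 0 a 0) ` {..<2 ^ n})"
  proof (clarsimp simp: pairwise_def)
    fix a b assume "dyadic_tile n 0 a 0 \<noteq> dyadic_tile n 0 b 0"
    then have "a \<noteq> b" by auto
    then have "real a + 1 \<le> real b \<or> real b + 1 \<le> real a" by linarith
    then have "(real a + 1) / 2 ^ n \<le> real b / 2 ^ n \<or> (real b + 1) / 2 ^ n \<le> real a / 2 ^ n"
      by (auto intro: divide_right_mono)
    then show "interior (dyadic_tile n 0 a 0) \<inter> interior (dyadic_tile n 0 b 0) = {}"
      by (auto simp: dyadic_tile_def interior_Times)
  qed
qed

lemma tiling_prob_1: "tiling_prob n 1 = 1"
proof -
  have "bernoulli_pmf 1 = return_pmf True"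
  proof (rule pmf_eqI)
    show "pmf (bernoulli_pmf 1) b = pmf (return_pmf True) b" for b by (cases b) simp_all
  qed
  then have "availability n 1 = return_pmf (\<lambda>t. t \<in> dyadic_tiles n)"
    by (simp add: availability_def finite_dyadic_tiles)
  moreover have "(\<lambda>a. dyadic_tile n 0 a 0) ` {..<2 ^ n} \<subseteq> dyadic_tiles n"
    using column_in_dyadic_tiles by blast
  ultimately show ?thesis
    using columns_tile_unit_square[of n]
    by (auto simp: tiling_prob_def measure_return_pmf indicator_def)
qed

theorem mainTheorem3:
  shows "critical_prob \<ge> 0.785996"
  unfolding critical_prob_def
proof (rule cInf_greatest)
  show "{p \<in> {0..1}. (\<lambda>n. tiling_prob n p) \<longlonglongrightarrow> 1} \<noteq> {}"
    using tiling_prob_1 by (auto intro!: exI[of _ 1])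
  fix p :: real assume p: "p \<in> {p \<in> {0..1}. (\<lambda>n. tiling_prob n p) \<longlonglongrightarrow> 1}"
  show "0.785996 \<le> p"
  proof (rule ccontr)
    assume "\<not> 0.785996 \<le> p"
    then have "0 \<le> p" "p < 0.785996" using p by auto
    then show False using tiling_prob_not_tendsto_1[of p] stuck_bound_gt_quarter[of p] p by simp
  qed
qed

end
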